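(* Let $q=p^k$ be a power of a prime $p$ with $q\equiv 3\pmod 4$ and let $f:\mathbb{F}_q\to\mathbb{F}_q$ be a function. Then the following are equivalent: (1) $f$ preserves positivity on $M_n(\mathbb{F}_q)$ for some $n\ge 2$. (2) $f$ preserves positivity on $M_n(\mathbb{F}_q)$ for all $n\ge 2$. (3) $f(0)=0$ and $\eta(f(a)-f(b))=\eta(a-b)$ for all $a,b\in\mathbb{F}_q$. (4) $f$ is a positive multiple of a field automorphism of $\mathbb{F}_q$, i.e., there exist $c\in\mathbb{F}_q^+$ and $0\le\ell\le k-1$ such that $f(x)=cx^{p^\ell}$ for all $x\in\mathbb{F}_q$.
   Context: $\mathbb{F}_q$ is the finite field with $q$ elements, $\mathbb{F}_q^*=\mathbb{F}_q\setminus\{0\}$, $\mathbb{F}_q^+:=\{x^2:x\in\mathbb{F}_q^*\}$ is the set of positive elements, and $\mathbb{F}_q^-=\mathbb{F}_q^*\setminus\mathbb{F}_q^+$. For $q$ odd, the quadratic character $\eta:\mathbb{F}_q\to\{-1,0,1\}$ is given by $\eta(x)=1$ if $x\in\mathbb{F}_q^+$, $\eta(x)=-1$ if $x\in\mathbb{F}_q^-$, and $\eta(0)=0$. $M_n(\mathbb{F}_q)$ is the set of $n\times n$ matrices over $\mathbb{F}_q$. A matrix $A\in M_n(\mathbb{F}_q)$ is positive definite if $A$ is symmetric and all its leading principal minors are non-zero squares in $\mathbb{F}_q$. For $A=(a_{ij})$, write $f[A]:=(f(a_{ij}))$. The function $f$ preserves positivity on $M_n(\mathbb{F}_q)$ if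 $f[A]$ is positive definite for every positive definite $A\in M_n(\mathbb{F}_q)$. *)

theory Defs
  imports
    "Jordan_Normal_Form.Determinant"
    "Jordan_Normal_Form.DL_Submatrix"
    "Jordan_Normal_Form.Ring_Hom_Matrix"
    "HOL-Number_Theory.Cong"
begin

definition positive_elems :: "'a::field set" where
  "positive_elems = {x\<^sup>2 | x. x \<noteq> 0}"

definition negative_elems :: "'a::field set" where
  "negative_elems = (UNIV - {0}) - positive_elems"

definition quadratic_char :: "'a::field \<Rightarrow> int" where
  "quadratic_char x =
     (if x \<in> positive_elems then 1 else if x \<in> negative_elems then -1 else 0)"

(* Matrix indices start at 0, so the leading r by r block has index set {..<r}. *)
definition positive_definite :: "nat \<Rightarrow> 'a::field mat \<Rightarrow> bool" where
  "positive_definite n A \<longleftrightarrow>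
     A \<in> carrier_mat n n \<and> transpose_mat A = A \<and>
     (\<forall>r\<in>{1..n}. det (submatrix A {..<r} {..<r}) \<in> positive_elems)"

definition preserves_positivity :: "nat \<Rightarrow> ('a::field \<Rightarrow> 'a) \<Rightarrow> bool" where
  "preserves_positivity n f \<longleftrightarrow>
     (\<forall>A. positive_definite n A \<longrightarrow> positive_definite n (map_mat f A))"

end

theory Submission
  imports Defs
begin

text \<open>
  Write \<open>P\<close> for the non-zero squares. Since \<open>q \<equiv> 3 (mod 4)\<close>, \<open>- 1\<close> is not a square, so the
  field is the disjoint union of \<open>0\<close>, \<open>P\<close> and \<open>- P\<close>, and squaring permutes \<open>P\<close>. The four
  conditions are proved equivalent by going round the circle ``some \<open>n\<close>'', ``quadratic
  character'', ``\<open>c * x ^ p ^ l\<close>'', ``multiple of an automorphism'', ``all \<open>n\<close>''. Two of these steps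
  carry the proof.

  From positivity to the quadratic character (lemma \<open>preserves_quadratic_char\<close>). Padding with an
  identity block reduces every \<open>n\<close> to \<open>n = 2\<close>: if \<open>a\<close> and \<open>a * c - b\<^sup>2\<close> lie in \<open>P\<close>, then so do
  \<open>f a\<close> and \<open>f a * f c - (f b)\<^sup>2\<close>. The choice \<open>b = c\<close> turns the second condition into one about
  \<open>b * (a - b)\<close>, which makes \<open>f\<close> an order-preserving permutation of \<open>P\<close> for the tournament
  relation \<open>a - b \<in> P\<close>. It remains to extend this to \<open>- P\<close>. A one-way
  implication along an injective self-map of a finite set is automatically an equivalence, so on
  \<open>P\<close> the implication for minors can be reversed. As \<open>c\<close> and \<open>- c\<close> have the same square, comparing
  the minors with off-diagonal entry \<open>c\<close> and \<open>- c\<close> gives \<open>(f (- c))\<^sup>2 = (f c)\<^sup>2\<close>, and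
  \<open>f (- c) = f c\<close> is impossible. Since \<open>f\<close> is therefore odd, it only remains to compare \<open>a + c\<close> with
  \<open>f a + f c\<close> on \<open>P\<close>, where the finiteness argument applies once more.

  From the quadratic character to the Frobenius maps (lemma \<open>preserves_power_m_imp_frobenius\<close>, a
  theorem of Carlitz). Put \<open>q = 2 * m + 1\<close>, \<open>p = 2 * h + 1\<close>. The quadratic character is the
  power \<open>x ^ m\<close>, so \<open>(f x - f y) ^ m = (x - y) ^ m\<close>. The right side is a
  polynomial of degree \<open>m\<close> in \<open>x\<close>; expanding the left side in powers of \<open>f y\<close> and picking out
  one power shows that \<open>f x ^ s\<close> is given by a polynomial of degree at most \<open>m\<close> whenever the
  binomial coefficient \<open>m choose s\<close> is not divisible by \<open>p\<close>. On the other hand, a polynomial of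
  degree less than \<open>q\<close> is determined by its values. So if \<open>f\<close> has degree \<open>d\<close>, a power or product
  whose naive degree is below \<open>q = 2 * m + 1\<close> must in fact have degree at most \<open>m\<close>. Now \<open>f\<close> may be
  replaced by a Frobenius twist of degree \<open>d \<ge> p ^ (k - 1)\<close>. For it the exponents \<open>s \<le> h\<close> give
  \<open>h * d \<le> m\<close>, and the exponents \<open>s = h + p ^ r\<close> with \<open>0 < r < k\<close> show that all other twists
  \<open>f ^ p ^ r\<close> have degree below \<open>p ^ (k - 1)\<close>. In base \<open>p\<close> a twist rotates the digits of the
  exponents, so the last fact says that only the top digit can be non-zero in an exponent
  of \<open>f\<close>, and \<open>h * d \<le> m\<close> says that this digit is at most \<open>1\<close>. As \<open>f 0 = 0\<close>, a single monomial
  is left.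
\<close>

section \<open>Binomial coefficients modulo a prime\<close>

text \<open>
  Lucas' theorem for a split of the base-\<open>p\<close> expansion at one place. In characteristic \<open>p\<close> the
  polynomial \<open>(1 + X) ^ (n1 + p ^ r * n2)\<close> is \<open>(1 + X) ^ n1 * (1 + X ^ p ^ r) ^ n2\<close>, and for
  \<open>n1 < p ^ r\<close> the products of monomials of the two factors have distinct degrees.
\<close>
lemma binomial_split_prime_power:
  fixes r n1 n2 u v :: nat
  assumes ch: "prime CHAR('a::idom)"
    and lt: "n1 < CHAR('a) ^ r" "u < CHAR('a) ^ r"
  shows "(of_nat ((n1 + CHAR('a) ^ r * n2) choose (u + CHAR('a) ^ r * v)) :: 'a)
         = of_nat (n1 choose u) * of_nat (n2 choose v)"
proof -
  define P where "P = CHAR('a) ^ r"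
  have P: "P > 0" "n1 < P" "u < P" using lt ch by (auto simp: P_def prime_gt_0_nat)
  have c1: "coeff ([:1, 1:] ^ n :: 'a poly) i = of_nat (n choose i)" for i n
  proof (cases "i \<le> n")
    case True
    then show ?thesis by (subst coeff_linear_poly_power) auto
  next
    case False
    then have "degree ([:1, 1:] ^ n :: 'a poly) < i"
      using degree_linear_power[of "1 :: 'a" n] by linarith
    then show ?thesis using False by (simp add: coeff_eq_0 binomial_eq_0)
  qed
  have one: "[:1, 1:] = (1 + monom 1 1 :: 'a poly)"
    by (simp add: monom_altdef one_pCons)
  have frob: "[:1, 1:] ^ P = (1 + monom 1 P :: 'a poly)"
    unfolding one P_def using freshmans_dream'[of "CHAR('a) ^ r" r "1 :: 'a poly" "monom 1 1"] ch
    by (simp add: monom_power)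
  have "of_nat ((n1 + P * n2) choose (u + P * v)) = coeff ([:1, 1:] ^ (n1 + P * n2) :: 'a poly) (u + P * v)"
    by (simp add: c1)
  also have "[:1, 1:] ^ (n1 + P * n2) = (1 + monom 1 P) ^ n2 * [:1, 1 :: 'a:] ^ n1"
    by (simp only: power_add power_mult frob mult.commute)
  also have "(1 + monom 1 P) ^ n2 = (\<Sum>w\<le>n2. smult (of_nat (n2 choose w)) (monom (1::'a) (P * w)))"
    by (subst add.commute, subst binomial_ring) (simp add: monom_power of_nat_poly)
  also have "coeff (\<dots> * [:1, 1 :: 'a:] ^ n1) (u + P * v)
     = (\<Sum>w\<le>n2. of_nat (n2 choose w) * (if P * w \<le> u + P * v then of_nat (n1 choose (u + P * v - P * w)) else 0))"
    unfolding sum_distrib_right coeff_sum mult_smult_left coeff_smult coeff_monom_mult c1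
    by (intro sum.cong refl) auto
  also have "\<dots> = (\<Sum>w\<le>n2. if w = v then of_nat (n2 choose w) * of_nat (n1 choose u) else 0)"
  proof (intro sum.cong refl)
    fix w
    consider "w = v" | "w < v" | "w > v" by linarith
    then show "of_nat (n2 choose w) * (if P * w \<le> u + P * v then of_nat (n1 choose (u + P * v - P * w)) else 0)
         = (if w = v then of_nat (n2 choose w) * of_nat (n1 choose u) else (0::'a))"
    proof cases
      case 2
      then have "P * v \<ge> P * w + P" by (metis Suc_leI mult_Suc_right mult_le_mono2 add.commute)
      then have "u + P * v - P * w > n1" using P by linarith
      then show ?thesis using 2 by (simp add: binomial_eq_0)
    next
      case 3
      then have "P * w \<ge> P * v + P" by (metis Suc_leI mult_Suc_right mult_le_mono2 add.commute)
      then show ?thesis using 3 P by simp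
    qed simp
  qed
  also have "\<dots> = of_nat (n1 choose u) * of_nat (n2 choose v)"
    by (cases "v \<le> n2") (simp_all add: mult.commute binomial_eq_0)
  finally show ?thesis by (simp add: P_def)
qed

lemma prime_not_dvd_binomial:
  fixes p n s :: nat
  assumes "prime p" "\<And>i. i < s \<Longrightarrow> \<not> p dvd n - i"
  shows "\<not> p dvd (n choose s)"
  using assms(2)
proof (induction s)
  case (Suc s)
  have "Suc s * (n choose Suc s) = (n - s) * (n choose s)"
    by (metis binomial_absorb_comp binomial_absorption mult.commute)
  then show ?case using Suc assms(1) by (metis dvd_mult less_SucI lessI prime_dvd_mult_iff)
qed (use assms(1) in auto)

section \<open>Finite fields in which \<open>- 1\<close> is not a square\<close>

text \<open>
  The condition \<open>q \<equiv> 3 (mod 4)\<close> enters as: \<open>m = (q - 1) / 2\<close> is odd. Here \<open>m\<close> is the exponent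
  that computes the quadratic character, and \<open>h\<close> is its analogue \<open>(p - 1) / 2\<close> for the prime field,
  which is also every base-\<open>p\<close> digit of \<open>m\<close>.
\<close>
locale field_card_3_mod_4 =
  fixes p k q m h :: nat and field_type :: "'a::{field,finite} itself"
  assumes prime_p: "prime p"
    and q_eq: "q = p ^ k"
    and q_eq_m: "q = 2 * m + 1"
    and odd_m: "odd m"
    and p_eq_h: "p = 2 * h + 1"
    and card_field: "card (UNIV :: 'a set) = q"
begin

abbreviation pos :: "'a set" where "pos \<equiv> positive_elems"

lemma m_pos: "m > 0" using odd_m by (rule odd_pos)
lemma k_pos: "k > 0" using q_eq q_eq_m m_pos by (cases k) auto
lemma odd_p: "odd p" using p_eq_h by simp
lemma p_ge_3: "p \<ge> 3" using odd_p prime_p prime_ge_2_nat[of p] by (cases "p = 2") auto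
lemma q_ge_3: "q \<ge> 3" using q_eq_m m_pos by simp

lemma char_p: "CHAR('a) = p"
proof -
  have "(\<Sum>x\<in>UNIV. x + 1 :: 'a) = (\<Sum>x\<in>UNIV. x)"
    by (rule sum.reindex_bij_witness[of _ "\<lambda>x. x - 1" "\<lambda>x. x + 1"]) auto
  then have "(of_nat q :: 'a) = 0" by (simp add: sum.distrib card_field)
  then have "CHAR('a) dvd p ^ k" by (simp only: of_nat_eq_0_iff_char_dvd q_eq)
  moreover have "prime CHAR('a)" by (intro prime_CHAR_semidom finite_imp_CHAR_pos) simp
  ultimately show ?thesis using prime_p by (metis prime_dvd_power primes_dvd_imp_eq)
qed

lemma two_neq_0: "(2 :: 'a) \<noteq> 0"
proof
  assume "(2::'a) = 0"
  then have "p dvd 2" using of_nat_eq_0_iff_char_dvd[where 'a='a, of 2] char_p by simp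
  then show False using p_ge_3 by (auto dest: dvd_imp_le)
qed

lemma frobenius_add: "(x + y :: 'a) ^ p ^ r = x ^ p ^ r + y ^ p ^ r"
  using freshmans_dream'[of "p ^ r" r x y] char_p prime_p by simp

lemma frobenius_diff: "(x - y :: 'a) ^ p ^ r = x ^ p ^ r - y ^ p ^ r"
  using frobenius_add[of "x - y" y r] by (simp add: algebra_simps)

lemma frobenius_sum: "(sum f A :: 'a) ^ p ^ r = (\<Sum>i\<in>A. f i ^ p ^ r)"
  using freshmans_dream_sum'[of "p ^ r" r f A] char_p prime_p by simp

lemma power_card_minus_1:
  fixes x :: 'a
  assumes "x \<noteq> 0"
  shows "x ^ (q - 1) = 1"
proof -
  have "(\<Prod>y\<in>UNIV-{0}. x * y) = (\<Prod>y\<in>UNIV-{0}. y)"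
    by (rule prod.reindex_bij_witness[of _ "\<lambda>y. y / x" "\<lambda>y. x * y"]) (use assms in auto)
  moreover have "(\<Prod>y\<in>UNIV-{0}. x * y) = x ^ (q - 1) * (\<Prod>y\<in>UNIV-{0}. y)"
    by (simp add: prod.distrib card_field)
  ultimately show ?thesis by simp
qed

lemma power_card: "(x :: 'a) ^ q = x"
proof (cases "x = 0")
  case False
  then show ?thesis using power_card_minus_1[of x] power_minus_mult[of q x] q_ge_3 by simp
qed (use q_ge_3 in simp)

lemma poly_eq_if_same_values:
  fixes A B :: "'a poly"
  assumes "degree A < q" "degree B < q" "\<And>x. poly A x = poly B x"
  shows "A = B"
  by (rule poly_eqI_degree[of UNIV]) (use assms card_field in auto)

text \<open>
  Some \<open>y \<noteq> 0\<close> has \<open>y ^ n \<noteq> 1\<close>, as \<open>X ^ n - 1\<close> has too few roots; substituting \<open>y * x\<close> for \<open>x\<close>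
  multiplies the sum by \<open>y ^ n\<close> and leaves it unchanged.
\<close>
lemma power_sum_eq_0:
  assumes "0 < n" "n < q - 1"
  shows "(\<Sum>x\<in>UNIV. x ^ n :: 'a) = 0"
proof -
  have "\<exists>y::'a. y \<noteq> 0 \<and> y ^ n \<noteq> 1"
  proof (rule ccontr)
    assume "\<not> ?thesis"
    then have "poly (monom 1 (n + 1)) x = poly (monom 1 1) x" for x :: 'a
      using assms by (cases "x = 0") (auto simp: poly_monom)
    then have "monom 1 (n + 1) = (monom 1 1 :: 'a poly)"
      by (intro poly_eq_if_same_values) (use assms in \<open>auto simp: degree_monom_eq\<close>)
    then show False using assms by (simp add: monom_eq_iff')
  qed
  then obtain y :: 'a where y: "y \<noteq> 0" "y ^ n \<noteq> 1" by blast
  have "(\<Sum>x\<in>UNIV. x ^ n) = (\<Sum>x\<in>UNIV. (y * x) ^ n)"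
    by (rule sum.reindex_bij_witness[of _ "\<lambda>x. y * x" "\<lambda>x. x / y"]) (use y in auto)
  also have "\<dots> = y ^ n * (\<Sum>x\<in>UNIV. x ^ n)" by (simp add: power_mult_distrib sum_distrib_left)
  finally show ?thesis using y by simp
qed

text \<open>
  Power sums serve below as linear functionals that read off coefficients. The value at \<open>n = 0\<close>
  is \<open>q = 0\<close>, because \<open>0 ^ 0 = 1\<close>.
\<close>
lemma power_sum:
  assumes "n < 2 * (q - 1)"
  shows "(\<Sum>x\<in>UNIV. x ^ n :: 'a) = (if n = q - 1 then - 1 else 0)"
proof -
  have c: "of_nat q = (0 :: 'a)" using char_p k_pos of_nat_eq_0_iff_char_dvd[where 'a='a] q_eq by simp
  consider "n = 0" | "0 < n" "n < q - 1" | "n = q - 1" | "n > q - 1" by linarith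
  then show ?thesis
  proof cases
    case 1
    then show ?thesis using c q_ge_3 card_field by simp
  next
    case 3
    have "(\<Sum>x\<in>UNIV. x ^ (q - 1) :: 'a) = (\<Sum>x\<in>UNIV - {0 :: 'a}. 1)"
      by (rule sum.mono_neutral_cong_right)
       (use q_ge_3 power_card_minus_1 in \<open>auto simp: power_0_left simp del: One_nat_def\<close>)
    also have "\<dots> = of_nat q - 1" using q_ge_3 card_field by (simp add: of_nat_diff)
    finally show ?thesis using c 3 by simp
  next
    case 4
    have "x ^ n = x ^ (n - (q - 1))" for x :: 'a
    proof (cases "x = 0")
      case False
      have "x ^ n = x ^ (n - (q - 1)) * x ^ (q - 1)" using 4 by (simp flip: power_add)
      then show ?thesis using power_card_minus_1[OF False] by simp
    qed (use 4 in \<open>auto simp: power_0_left\<close>)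
    then show ?thesis using power_sum_eq_0[of "n - (q - 1)"] 4 assms by simp
  qed (use power_sum_eq_0 in auto)
qed

lemma positive_iff: "x \<in> pos \<longleftrightarrow> (\<exists>y. y \<noteq> 0 \<and> x = y\<^sup>2)"
  by (auto simp: positive_elems_def)

lemma zero_not_pos [simp]: "0 \<notin> pos" by (auto simp: positive_iff)
lemma one_pos [simp]: "1 \<in> pos" by (auto simp: positive_iff intro!: exI[of _ 1])
lemma square_pos: "x \<noteq> 0 \<Longrightarrow> x\<^sup>2 \<in> pos" by (auto simp: positive_iff)

lemma mult_pos: "x \<in> pos \<Longrightarrow> y \<in> pos \<Longrightarrow> x * y \<in> pos"
  unfolding positive_iff by (metis mult_eq_0_iff power_mult_distrib)

lemma inverse_pos: "x \<in> pos \<Longrightarrow> inverse x \<in> pos"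
  unfolding positive_iff by (metis inverse_nonzero_iff_nonzero power_inverse)

lemma divide_pos: "x \<in> pos \<Longrightarrow> y \<in> pos \<Longrightarrow> x / y \<in> pos"
  by (simp add: divide_inverse mult_pos inverse_pos)

lemma mult_pos_iff: "x \<in> pos \<Longrightarrow> x * y \<in> pos \<longleftrightarrow> y \<in> pos"
  using mult_pos[of x y] divide_pos[of "x * y" x] by (cases "x = 0") auto

lemma pos_power_m:
  assumes "x \<in> pos" shows "x ^ m = 1"
proof -
  obtain y where "y \<noteq> 0" "x = y ^ 2" using assms positive_iff by blast
  then show ?thesis using power_card_minus_1[of y] q_eq_m by (simp flip: power_mult)
qed

lemma minus_one_neq_one: "(- 1 :: 'a) \<noteq> 1" "1 \<noteq> (- 1 :: 'a)"
  using two_neq_0 by (metis add.right_inverse one_add_one)+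

lemma minus_one_not_pos: "- 1 \<notin> pos"
  using pos_power_m[of "- 1"] odd_m minus_one_neq_one by auto

lemma uminus_pos: "x \<in> pos \<Longrightarrow> - x \<notin> pos"
  using mult_pos_iff[of x "- 1"] minus_one_not_pos by simp

lemma square_inj_pos:
  assumes "x \<in> pos" "y \<in> pos" "x\<^sup>2 = y\<^sup>2"
  shows "x = y"
  using assms uminus_pos[of x] by (auto simp: power2_eq_iff)

text \<open>
  Squaring is injective on \<open>P\<close> because \<open>- 1\<close> is not a square, hence it permutes \<open>P\<close>. So \<open>x\<^sup>2\<close> is
  the square of some \<open>y \<in> P\<close>, and \<open>x = \<plusminus> y\<close>.
\<close>
lemma pos_or_uminus_pos:
  assumes "x \<noteq> 0"
  shows "x \<in> pos \<or> - x \<in> pos"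
proof -
  have "inj_on (\<lambda>x. x\<^sup>2) pos" using square_inj_pos by (auto intro: inj_onI)
  moreover have "(\<lambda>x. x\<^sup>2) ` pos \<subseteq> pos" by (auto intro!: square_pos)
  ultimately have "(\<lambda>x. x\<^sup>2) ` pos = pos" by (intro endo_inj_surj) auto
  then obtain y where "y \<in> pos" "x\<^sup>2 = y\<^sup>2" using square_pos[OF assms] by auto
  then show ?thesis by (auto simp: power2_eq_iff)
qed

lemma uminus_pos_iff: "x \<noteq> 0 \<Longrightarrow> - x \<in> pos \<longleftrightarrow> x \<notin> pos"
  using pos_or_uminus_pos uminus_pos by blast

lemma power_m:
  "(x :: 'a) ^ m = (if x = 0 then 0 else if x \<in> pos then 1 else - 1)"
proof -
  note m_pos
  moreover have "x ^ m = - 1" if "x \<noteq> 0" "x \<notin> pos"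
  proof -
    have "- (x ^ m) = 1"
      using pos_power_m[of "- x"] uminus_pos_iff[of x] power_minus_odd[OF odd_m, of x] that by simp
    then show ?thesis by (metis minus_minus)
  qed
  ultimately show ?thesis using pos_power_m by auto
qed

lemma quadratic_char_eq_iff:
  "quadratic_char (x::'a) = quadratic_char y \<longleftrightarrow> (x = 0 \<longleftrightarrow> y = 0) \<and> (x \<in> pos \<longleftrightarrow> y \<in> pos)"
  by (auto simp: quadratic_char_def negative_elems_def)

lemma quadratic_char_preserved_iff:
  "(\<forall>a b. quadratic_char (f a - f b) = quadratic_char (a - b :: 'a)) \<longleftrightarrow>
   (\<forall>a b. (f a - f b) ^ m = (a - b) ^ m)" for f :: "'a \<Rightarrow> 'a"
proof -
  have "quadratic_char x = quadratic_char y \<longleftrightarrow> x ^ m = y ^ m" for x y :: 'a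
    unfolding quadratic_char_eq_iff power_m using minus_one_neq_one by auto
  then show ?thesis by simp
qed

end

section \<open>Positive definite matrices and the reduction to size two\<close>

lemma leading_submatrix:
  assumes "A \<in> carrier_mat n n" "r \<le> n"
  shows "submatrix A {..<r} {..<r} = mat r r (\<lambda>ij. A $$ ij)"
proof (rule eq_matI)
  have "{i. i < n \<and> i \<in> {..<r}} = {..<r}" using assms by auto
  then show "dim_row (submatrix A {..<r} {..<r}) = dim_row (mat r r (\<lambda>ij. A $$ ij))"
    "dim_col (submatrix A {..<r} {..<r}) = dim_col (mat r r (\<lambda>ij. A $$ ij))"
    using assms(1) by (auto simp: dim_submatrix)
next
  fix i j assume "i < dim_row (mat r r (\<lambda>ij. A $$ ij))" "j < dim_col (mat r r (\<lambda>ij. A $$ ij))"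
  then have ij: "i < r" "j < r" by auto
  have "{a \<in> {..<r}. a < l} = {..<l}" if "l < r" for l using that by auto
  then show "submatrix A {..<r} {..<r} $$ (i, j) = mat r r (\<lambda>ij. A $$ ij) $$ (i, j)"
    using submatrix_index_card[of i A j "{..<r}" "{..<r}"] ij assms by simp
qed

text \<open>
  Restricting the index function is easier to compute with than picking the rows and columns of
  an index set.
\<close>
lemma positive_definite_iff:
  "positive_definite n A \<longleftrightarrow>
     A \<in> carrier_mat n n \<and> transpose_mat A = A \<and>
     (\<forall>r\<in>{1..n}. det (mat r r (\<lambda>ij. A $$ ij)) \<in> positive_elems)"
  unfolding positive_definite_def using leading_submatrix[of A n] by auto

lemma det_mat_2:
  "det (mat 2 2 g) = g (0, 0) * g (1, 1) - g (0, 1) * (g (1, 0) :: 'a :: comm_ring_1)"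
proof -
  have d: "det (mat_delete (mat 2 2 g) i 0) = g (1 - i, 1)" if "i < 2" for i
  proof -
    have "mat_delete (mat 2 2 g) i 0 \<in> carrier_mat 1 1" by (auto simp: mat_delete_def)
    moreover have "mat_delete (mat 2 2 g) i 0 $$ (0, 0) = g (1 - i, 1)"
      using that by (auto simp: mat_delete_def)
    ultimately show ?thesis using det_single by metis
  qed
  have "det (mat 2 2 g) = (\<Sum>i<2. mat 2 2 g $$ (i, 0) * cofactor (mat 2 2 g) i 0)"
    by (rule laplace_expansion_column) auto
  also have "\<dots> = g (0, 0) * g (1, 1) - g (0, 1) * g (1, 0)"
    using d[of 0] d[of 1] by (simp add: cofactor_def numeral_2_eq_2 mult.commute)
  finally show ?thesis .
qed

text \<open>
  The block sum of the symmetric matrix with rows \<open>(a, b)\<close> and \<open>(b, c)\<close> and an identity matrix. Every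
  leading minor from size two on equals \<open>a * c - b\<^sup>2\<close>.
\<close>
definition pad_2_by_2 :: "nat \<Rightarrow> 'a \<Rightarrow> 'a \<Rightarrow> 'a \<Rightarrow> 'a::field mat" where
  "pad_2_by_2 n a b c = mat n n (\<lambda>(i, j).
     if i = 0 \<and> j = 0 then a else if i = 1 \<and> j = 1 then c else if i < 2 \<and> j < 2 then b
     else if i = j then 1 else 0)"

lemma positive_definite_pad:
  assumes "n \<ge> 2" "a \<in> positive_elems" "a * c - b\<^sup>2 \<in> positive_elems"
  shows "positive_definite n (pad_2_by_2 n a b c)"
proof -
  let ?g = "\<lambda>(i :: nat, j :: nat).
     if i = 0 \<and> j = 0 then a else if i = 1 \<and> j = 1 then c else if i < 2 \<and> j < 2 then b
     else if i = j then 1 else 0"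
  have lead: "mat r r (\<lambda>ij. pad_2_by_2 n a b c $$ ij) = mat r r ?g" if "r \<le> n" for r
    using that by (intro eq_matI) (auto simp: pad_2_by_2_def)
  have two: "det (mat 2 2 ?g) = a * c - b\<^sup>2"
    by (subst det_mat_2) (simp add: power2_eq_square)
  have "det (mat r r ?g) \<in> positive_elems" if "1 \<le> r" for r
  proof (cases "r = 1")
    case True
    then show ?thesis using assms(2) by (subst det_single) auto
  next
    case False
    have "mat r r ?g = four_block_mat (mat 2 2 ?g) (0\<^sub>m 2 (r - 2)) (0\<^sub>m (r - 2) 2) (1\<^sub>m (r - 2))"
      using that False by (intro eq_matI) auto
    then have "det (mat r r ?g) = det (mat 2 2 ?g)"
      by (simp add: det_four_block_mat_upper_right_zero[of _ 2 _ "r - 2"])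
    then show ?thesis using two assms(3) by simp
  qed
  moreover have "transpose_mat (pad_2_by_2 n a b c) = pad_2_by_2 n a b c"
    by (intro eq_matI) (auto simp: pad_2_by_2_def)
  ultimately show ?thesis
    unfolding positive_definite_iff using lead by (auto simp: pad_2_by_2_def)
qed

text \<open>
  Only the first two leading minors of the image are looked at. They do not involve the
  padding, so the unknown values \<open>f 0\<close> and \<open>f 1\<close> there do no harm.
\<close>
lemma preserves_positivity_2_by_2:
  assumes f: "preserves_positivity n f" and n: "n \<ge> 2"
    and ac: "a \<in> positive_elems" "a * c - b\<^sup>2 \<in> positive_elems"
  shows "f a \<in> positive_elems" "f a * f c - (f b)\<^sup>2 \<in> positive_elems"
proof -
  let ?A = "map_mat f (pad_2_by_2 n a b c)"
  have pd: "positive_definite n ?A"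
    using f positive_definite_pad[OF n ac] by (auto simp: preserves_positivity_def)
  have minor: "det (mat r r (\<lambda>ij. ?A $$ ij)) \<in> positive_elems" if "r \<in> {1..n}" for r
    using pd that unfolding positive_definite_iff by blast
  show "f a \<in> positive_elems"
    using minor[of 1] det_single[of "mat 1 1 (\<lambda>ij. ?A $$ ij)"] n by (simp add: pad_2_by_2_def)
  show "f a * f c - (f b)\<^sup>2 \<in> positive_elems"
    using minor[of 2] det_mat_2[of "\<lambda>ij. ?A $$ ij"] n by (simp add: pad_2_by_2_def power2_eq_square)
qed

context field_card_3_mod_4
begin

text \<open>
  The minor of size \<open>r\<close> of the image is \<open>c ^ r * \<sigma> d\<close>, where \<open>d\<close> is the minor of the original
  matrix, and \<open>\<sigma>\<close> maps squares to squares.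
\<close>
lemma multiple_of_field_isom_preserves_positivity:
  fixes f :: "'a \<Rightarrow> 'a"
  assumes c: "c \<in> pos" and \<sigma>: "field_isom \<sigma>" and f: "\<And>x. f x = c * \<sigma> x"
  shows "preserves_positivity n f"
  unfolding preserves_positivity_def
proof (intro allI impI)
  interpret field_isom \<sigma> by fact
  have hom_pos: "\<sigma> x \<in> pos" if "x \<in> pos" for x
    using that unfolding positive_iff by (metis hom_power hom_0_iff)
  have power_pos: "c ^ r \<in> pos" for r by (induction r) (use c mult_pos in auto)
  fix A :: "'a mat" assume A: "positive_definite n A"
  then have carrier: "A \<in> carrier_mat n n" and symm: "transpose_mat A = A"
    by (auto simp: positive_definite_def)
  have entry: "A $$ (i, j) = A $$ (j, i)" if "i < n" "j < n" for i j
    using symm carrier that by (metis carrier_matD index_transpose_mat(1))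
  have "transpose_mat (map_mat f A) = map_mat f A"
    using carrier entry by (intro eq_matI) auto
  moreover have "det (mat r r (\<lambda>ij. map_mat f A $$ ij)) \<in> pos" if r: "r \<in> {1..n}" for r
  proof -
    let ?M = "mat r r (\<lambda>ij. A $$ ij)"
    have "mat r r (\<lambda>ij. map_mat f A $$ ij) = c \<cdot>\<^sub>m map_mat \<sigma> ?M"
      using r carrier f by (intro eq_matI) auto
    then have "det (mat r r (\<lambda>ij. map_mat f A $$ ij)) = c ^ r * \<sigma> (det ?M)" by simp
    moreover have "det ?M \<in> pos" using A r unfolding positive_definite_iff by blast
    ultimately show ?thesis using mult_pos[OF power_pos hom_pos] by simp
  qed
  ultimately show "positive_definite n (map_mat f A)"
    using carrier unfolding positive_definite_iff by auto
qed

end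

section \<open>Positivity preservers preserve the quadratic character\<close>

text \<open>
  The finiteness principle that turns one-way implications into equivalences: an injective map
  that sends the set \<open>T\<close> of solutions of a condition into itself permutes \<open>T\<close>.
\<close>
lemma inj_endo_reflects:
  assumes "finite S" "inj_on F S" "T \<subseteq> S" "F ` T \<subseteq> T" "t \<in> S" "F t \<in> T"
  shows "t \<in> T"
proof -
  have "F ` T = T"
    using assms by (intro endo_inj_surj) (auto intro: finite_subset inj_on_subset)
  then show ?thesis using assms by (metis imageE inj_onD subsetD)
qed

context field_card_3_mod_4
begin

text \<open>
  Otherwise \<open>P\<close> would be closed under adding \<open>1\<close> (after scaling \<open>c\<close> to \<open>1\<close>) and contain
  \<open>1, 2, \<dots>, p = 0\<close>.
\<close>
lemma exists_pos_plus_not_pos: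
  assumes "c \<in> pos"
  obtains a where "a \<in> pos" "a + c \<notin> pos"
proof -
  have "\<exists>x\<in>pos. x + 1 \<notin> pos"
  proof (rule ccontr)
    assume "\<not> ?thesis"
    then have "of_nat (Suc n) \<in> pos" for n
      by (induction n) (auto simp: add.commute)
    from this[of "p - 1"] have "(of_nat p :: 'a) \<in> pos" using p_ge_3 by simp
    then show False using char_p of_nat_CHAR[where 'a='a] by simp
  qed
  then obtain x where "x \<in> pos" "x + 1 \<notin> pos" by blast
  then have "c * x \<in> pos" "c * x + c \<notin> pos"
    using assms mult_pos[of c x] mult_pos_iff[of c "x + 1"] by (auto simp: distrib_left)
  then show thesis by (rule that)
qed

text \<open>
  Let \<open>R t\<close> be the set of \<open>x \<in> P\<close> with \<open>s * x - t \<in> P\<close>. Scaling by elements of \<open>P\<close> shows that all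
  the sets \<open>R t\<close> with \<open>t \<in> P\<close> are equally large, so the inclusion of \<open>R u\<close> in \<open>R v\<close> is an equality.
  As \<open>u / s\<close> is not in \<open>R u\<close> it is not in \<open>R v\<close>, so \<open>u - v \<notin> P\<close>, and \<open>v - u \<notin> P\<close> by symmetry.
\<close>
lemma eq_if_pos_shift_subset:
  assumes "s \<in> pos" "u \<in> pos" "v \<in> pos"
    and sub: "\<And>x. x \<in> pos \<Longrightarrow> s * x - u \<in> pos \<Longrightarrow> s * x - v \<in> pos"
  shows "u = v"
proof -
  define R where "R = (\<lambda>t. {x \<in> pos. s * x - t \<in> pos})"
  have "card (R v) \<le> card (R u)"
  proof (rule card_inj_on_le)
    show "inj_on (\<lambda>x. x * (u / v)) (R v)" using assms by (auto intro!: inj_onI)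
    show "(\<lambda>x. x * (u / v)) ` R v \<subseteq> R u"
    proof safe
      fix x assume x: "x \<in> R v"
      have "v \<noteq> 0" using assms(3) by auto
      then have "s * (x * (u / v)) - u = (u / v) * (s * x - v)" by (simp add: field_simps)
      then show "x * (u / v) \<in> R u"
        using x assms by (auto simp: R_def intro!: mult_pos divide_pos)
    qed
  qed simp
  then have eq: "R u = R v" using sub by (intro card_seteq) (auto simp: R_def)
  have "s \<noteq> 0" using assms(1) by auto
  then have mem: "t / s \<in> R t' \<longleftrightarrow> t - t' \<in> pos" if "t \<in> pos" for t t'
    using that assms(1) divide_pos by (simp add: R_def)
  have "u - v \<notin> pos" "v - u \<notin> pos"
    using mem[of u u] mem[of u v] mem[of v v] mem[of v u] eq assms by auto
  then show "u = v" using uminus_pos_iff[of "u - v"] by auto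
qed

text \<open>
  The hypothesis is evaluated on well-chosen matrices of size two. The matrices with
  \<open>b = c\<close> have determinant \<open>b * (a - b)\<close> and control differences. The matrices with top left entry
  \<open>1\<close> see \<open>b\<close> only through \<open>b\<^sup>2\<close> and so tie \<open>f (- c)\<close> to \<open>f c\<close>.
\<close>
lemma preserves_quadratic_char:
  fixes f :: "'a \<Rightarrow> 'a"
  assumes "preserves_positivity n f" "n \<ge> 2"
  shows "f 0 = 0" "quadratic_char (f a - f b) = quadratic_char (a - b)"
proof -
  note pp = preserves_positivity_2_by_2[OF assms]
  have f_pos: "f x \<in> pos" if "x \<in> pos" for x
    using pp(1)[of x 1 0] that by simp
  have nz: "x \<noteq> 0" if "x \<in> pos" for x using that by auto
  have one_column: "f b * (f a - f b) \<in> pos" if "a \<in> pos" "b * (a - b) \<in> pos" for a b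
    using pp(2)[of a b b] that by (simp add: algebra_simps power2_eq_square)
  have diff_pos: "f a - f b \<in> pos" if "a \<in> pos" "b \<in> pos" "a - b \<in> pos" for a b
    using one_column[of a b] that f_pos mult_pos_iff by auto
  have diff_pos_iff: "f a - f b \<in> pos \<longleftrightarrow> a - b \<in> pos" if "a \<in> pos" "b \<in> pos" for a b
  proof (cases "a = b")
    case False
    then show ?thesis
      using diff_pos[of a b] diff_pos[of b a] that uminus_pos[of "f b - f a"] uminus_pos_iff[of "a - b"]
      by auto
  qed simp
  have inj: "inj_on f pos"
    using diff_pos_iff uminus_pos_iff by (metis inj_onI diff_self eq_iff_diff_eq_0 minus_diff_eq zero_not_pos)
  have surj: "f ` pos = pos"
    using inj f_pos by (intro endo_inj_surj) auto
  show f0: "f 0 = 0"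
  proof (rule ccontr)
    assume "f 0 \<noteq> 0"
    (* f attains both (f 0)^2 and 1 on P: a diagonal matrix is then sent to a singular one *)
    then have "(f 0)\<^sup>2 \<in> f ` pos" "1 \<in> f ` pos" using surj square_pos by auto
    then obtain a c where "a \<in> pos" "c \<in> pos" "f a = (f 0)\<^sup>2" "f c = 1" by auto
    then show False using pp(2)[of a c 0] mult_pos by simp
  qed
  (* f acts injectively on triples from P, so on P the implication for minors can be reversed *)
  have minor_reflected: "a * x - c\<^sup>2 \<in> pos"
    if "f a * f x - (f c)\<^sup>2 \<in> pos" "a \<in> pos" "x \<in> pos" "c \<in> pos" for a x c
  proof -
    define T where "T = {(a, x, c). a \<in> pos \<and> x \<in> pos \<and> c \<in> pos \<and> a * x - c\<^sup>2 \<in> pos}"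
    have "(a, x, c) \<in> T"
      by (rule inj_endo_reflects[of "pos \<times> pos \<times> pos" "map_prod f (map_prod f f)"])
         (use inj f_pos pp(2) that in \<open>auto simp: T_def intro!: map_prod_inj_on\<close>)
    then show ?thesis by (simp add: T_def)
  qed
  have f_minus: "f (- c) = - f c" if c: "c \<in> pos" for c
  proof -
    have shifted: "f (- c) * (f a - f (- c)) \<in> pos" if "a \<in> pos" "a + c \<notin> pos" for a
    proof (rule one_column)
      have "a + c \<noteq> 0" using that c uminus_pos[of c] by (metis add_eq_0_iff2)
      then have "- (a + c) \<in> pos" using that uminus_pos_iff by blast
      then show "- c * (a - - c) \<in> pos" using mult_pos[OF c] by (metis minus_mult_commute diff_minus_eq_add)
    qed (use that in simp)
    obtain a0 where "a0 \<in> pos" "a0 + c \<notin> pos" using exists_pos_plus_not_pos[OF c] .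
    then have nz_minus: "f (- c) \<noteq> 0" using shifted by fastforce
    have "(f c)\<^sup>2 = (f (- c))\<^sup>2"
    proof (rule eq_if_pos_shift_subset[of "f 1"])
      fix y assume y: "y \<in> pos" "f 1 * y - (f c)\<^sup>2 \<in> pos"
      then obtain x where x: "x \<in> pos" "f x = y" using surj by (metis imageE)
      have "1 * x - c\<^sup>2 \<in> pos"
        using minor_reflected[of 1 x c] x y c by simp
      then show "f 1 * y - (f (- c))\<^sup>2 \<in> pos"
        using pp(2)[of 1 x "- c"] x by simp
    next
      show "f 1 \<in> pos" "(f c)\<^sup>2 \<in> pos" using f_pos[OF one_pos] square_pos[OF nz[OF f_pos[OF c]]] by auto
      show "(f (- c))\<^sup>2 \<in> pos" by (rule square_pos[OF nz_minus])
    qed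
    moreover have "f (- c) \<noteq> f c"
    proof
      assume same: "f (- c) = f c"
      (* the condition a0 + c not in P is invariant under a0 -> c^2 / a0, which flips the sign of a0 - c *)
      have contra: "a - c \<in> pos" if "a \<in> pos" "a + c \<notin> pos" for a
        using shifted[OF that] same mult_pos_iff[OF f_pos[OF c]] diff_pos_iff[OF that(1) c] by simp
      have "c * c / a0 \<in> pos" using c \<open>a0 \<in> pos\<close> mult_pos divide_pos by blast
      have "a0 \<noteq> 0" using nz \<open>a0 \<in> pos\<close> by blast
      then have "(c / a0) * (a0 + c) = c * c / a0 + c" "(c / a0) * (a0 - c) = - (c * c / a0 - c)"
        by (auto simp: field_simps)
      then have "c * c / a0 + c \<notin> pos" "- (c * c / a0 - c) \<in> pos"
        using mult_pos_iff[OF divide_pos[OF c \<open>a0 \<in> pos\<close>], of "a0 + c"]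
          mult_pos_iff[OF divide_pos[OF c \<open>a0 \<in> pos\<close>], of "a0 - c"]
          \<open>a0 + c \<notin> pos\<close> contra[OF \<open>a0 \<in> pos\<close>] by simp_all
      then show False using contra[of "c * c / a0"] uminus_pos[of "c * c / a0 - c"] \<open>c * c / a0 \<in> pos\<close> by blast
    qed
    ultimately show ?thesis by (auto simp: power2_eq_iff)
  qed
  have sum_not_pos: "f a + f c \<notin> pos" if ac: "a \<in> pos" "c \<in> pos" "a + c \<notin> pos" for a c
  proof -
    have "a + c \<noteq> 0" using ac uminus_pos[of c] by (metis add_eq_0_iff2)
    then have "c * - (a + c) \<in> pos" using ac uminus_pos_iff mult_pos by blast
    then have "- c * (a - - c) \<in> pos" by (metis minus_mult_commute diff_minus_eq_add)
    then have "f (- c) * (f a - f (- c)) \<in> pos" using one_column ac by blast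
    then have "f c * - (f a + f c) \<in> pos" using f_minus[OF ac(2)]
      by (metis minus_mult_commute diff_minus_eq_add)
    then have "- (f a + f c) \<in> pos" using mult_pos_iff[OF f_pos[OF ac(2)]] by blast
    then show ?thesis using uminus_pos by (metis minus_minus)
  qed
  have sum_pos_iff: "f a + f c \<in> pos \<longleftrightarrow> a + c \<in> pos" if ac: "a \<in> pos" "c \<in> pos" for a c
  proof
    assume "a + c \<in> pos"
    define T where "T = {(a, c). a \<in> pos \<and> c \<in> pos \<and> a + c \<notin> pos}"
    show "f a + f c \<in> pos"
    proof (rule ccontr)
      assume *: "f a + f c \<notin> pos"
      have "(a, c) \<in> T"
        by (rule inj_endo_reflects[of "pos \<times> pos" "map_prod f f"])
           (use inj f_pos sum_not_pos ac * in \<open>auto simp: T_def intro!: map_prod_inj_on\<close>)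
      then show False using \<open>a + c \<in> pos\<close> by (simp add: T_def)
    qed
  qed (use sum_not_pos ac in blast)
  have cases: "x = 0 \<or> x \<in> pos \<or> (\<exists>c\<in>pos. x = - c)" for x
    using pos_or_uminus_pos[of x] by (metis minus_minus)
  have minus_sum_iff: "- (f a + f c) \<in> pos \<longleftrightarrow> - (a + c) \<in> pos" if ac: "a \<in> pos" "c \<in> pos" for a c
  proof -
    have "a + c \<noteq> 0" "f a + f c \<noteq> 0" using ac f_pos uminus_pos by (metis add_eq_0_iff2)+
    then show ?thesis using uminus_pos_iff sum_pos_iff[OF ac] by metis
  qed
  have iff: "f a - f b \<in> pos \<longleftrightarrow> a - b \<in> pos" for a b
  proof -
    consider "a = 0" | "b = 0" | "a \<in> pos" "b \<in> pos" | c where "a \<in> pos" "c \<in> pos" "b = - c"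
      | c where "c \<in> pos" "b \<in> pos" "a = - c" | c d where "c \<in> pos" "d \<in> pos" "a = - c" "b = - d"
      using cases[of a] cases[of b] by blast
    then show ?thesis
    proof cases
      case 1
      then show ?thesis using cases[of b] f0 f_minus f_pos uminus_pos by auto
    next
      case 2
      then show ?thesis using cases[of a] f0 f_minus f_pos uminus_pos by auto
    next
      case 3
      then show ?thesis by (rule diff_pos_iff)
    next
      case (4 c)
      then show ?thesis using sum_pos_iff[of a c] f_minus by simp
    next
      case (5 c)
      then have "f a - f b = - (f c + f b)" "a - b = - (c + b)" using f_minus by auto
      then show ?thesis using minus_sum_iff[of c b] 5 by metis
    next
      case (6 c d)
      then show ?thesis using diff_pos_iff[of d c] f_minus by simp
    qed
  qed
  have "(f a - f b = 0 \<longleftrightarrow> a - b = 0)"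
    using iff[of a b] iff[of b a] pos_or_uminus_pos[of "a - b"] by auto
  then have "(f a - f b = 0 \<longleftrightarrow> a - b = 0) \<and> (f a - f b \<in> pos \<longleftrightarrow> a - b \<in> pos)"
    using iff by blast
  then show "quadratic_char (f a - f b) = quadratic_char (a - b)"
    by (simp add: quadratic_char_eq_iff)
qed

end

section \<open>Maps that preserve the quadratic character are Frobenius maps\<close>

lemma ex_max_shift:
  fixes d p N :: nat
  assumes "0 < d" "d < N" "2 \<le> p"
  obtains u where "d * p ^ u < N" "N \<le> d * p ^ Suc u"
proof -
  have "N < p ^ N" using assms(3) by (intro power_gt_expt) simp
  also have "\<dots> \<le> d * p ^ N" using assms(1) by simp
  finally have "\<exists>u<N. (\<forall>i\<le>u. \<not> N \<le> d * p ^ i) \<and> N \<le> d * p ^ Suc u"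
    using assms(2) by (intro ex_least_nat_less) auto
  then show thesis using that by (meson not_le order_refl)
qed

context field_card_3_mod_4
begin

text \<open>
  A power sum selects the coefficient with \<open>l + (q - 1 - i) = q - 1\<close>; the bound on the degree keeps all
  exponents below \<open>2 * (q - 1)\<close>.
\<close>
lemma coeff_eq_power_sum:
  fixes A :: "'a poly"
  assumes "degree A \<le> m" "0 < i" "i \<le> q - 1"
  shows "(\<Sum>x\<in>UNIV. poly A x * x ^ (q - 1 - i)) = - coeff A i"
proof -
  have "(\<Sum>x\<in>UNIV. poly A x * x ^ (q - 1 - i))
      = (\<Sum>x\<in>UNIV. \<Sum>l\<le>degree A. coeff A l * x ^ (l + (q - 1 - i)))"
    by (simp add: poly_altdef sum_distrib_right power_add mult.assoc)
  also have "\<dots> = (\<Sum>l\<le>degree A. coeff A l * (\<Sum>x\<in>UNIV. x ^ (l + (q - 1 - i))))"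
    by (subst sum.swap) (simp add: sum_distrib_left)
  also have "\<dots> = (\<Sum>l\<le>degree A. if l = i then - coeff A i else 0)"
  proof (intro sum.cong refl)
    fix l assume "l \<in> {..degree A}"
    then have "l + (q - 1 - i) < 2 * (q - 1)" using assms q_eq_m by simp
    moreover have "l + (q - 1 - i) = q - 1 \<longleftrightarrow> l = i" using assms by auto
    ultimately show "coeff A l * (\<Sum>x\<in>UNIV. x ^ (l + (q - 1 - i))) = (if l = i then - coeff A i else 0)"
      using power_sum by simp
  qed
  also have "\<dots> = - coeff A i" by (auto simp: coeff_eq_0)
  finally show ?thesis .
qed

lemma bij_if_preserves_power_m:
  fixes f :: "'a \<Rightarrow> 'a"
  assumes "\<And>x y. (f x - f y) ^ m = (x - y) ^ m"
  shows "bij f"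
proof -
  have "inj f"
  proof (rule injI)
    fix x y assume "f x = f y"
    then have "(x - y) ^ m = 0" using assms[of x y] m_pos by (simp add: power_0_left)
    then show "x = y" by simp
  qed
  then show ?thesis by (simp add: bij_def finite_UNIV_inj_surj)
qed

text \<open>
  Consider the sum over \<open>y\<close> of \<open>(f x - f y) ^ m * f y ^ (m + s)\<close>. Since \<open>f\<close> is a bijection, \<open>f y\<close> may be
  replaced by a variable \<open>z\<close> that runs through the field; expanding binomially, the power sums kill
  all terms but the multiple of \<open>f x ^ s\<close>, whose coefficient is \<open>m choose s\<close> up to sign. On the
  other hand the sum is a linear combination of the polynomials \<open>(x - y) ^ m\<close>.
\<close>
lemma power_represented_degree_le:
  fixes f :: "'a \<Rightarrow> 'a"
  assumes f: "\<And>x y. (f x - f y) ^ m = (x - y) ^ m"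
    and s: "s \<le> m" "of_nat (m choose s) \<noteq> (0 :: 'a)"
  obtains A where "degree A \<le> m" "\<And>x. poly A x = f x ^ s"
proof -
  define c :: 'a where "c = - (of_nat (m choose s) * (- 1) ^ (m - s))"
  have c: "c \<noteq> 0" using s by (simp add: c_def)
  have extraction: "(\<Sum>y\<in>UNIV. (f x - f y) ^ m * f y ^ (m + s)) = c * f x ^ s" for x
  proof -
    have "(\<Sum>y\<in>UNIV. (f x - f y) ^ m * f y ^ (m + s)) = (\<Sum>z\<in>UNIV. (f x - z) ^ m * z ^ (m + s))"
      by (rule sum.reindex_bij_betw[OF bij_if_preserves_power_m[OF f]])
    also have "\<dots> = (\<Sum>z\<in>UNIV. \<Sum>i\<le>m. of_nat (m choose i) * f x ^ i * (- 1) ^ (m - i) * z ^ (2 * m + s - i))"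
    proof (intro sum.cong refl)
      fix z
      have "(f x - z) ^ m * z ^ (m + s) = (\<Sum>i\<le>m. of_nat (m choose i) * f x ^ i * (- z) ^ (m - i) * z ^ (m + s))"
        using binomial_ring[of "f x" "- z" m] by (simp add: sum_distrib_right)
      also have "\<dots> = (\<Sum>i\<le>m. of_nat (m choose i) * f x ^ i * (- 1) ^ (m - i) * z ^ (2 * m + s - i))"
      proof (intro sum.cong refl)
        fix i assume "i \<in> {..m}"
        then have "2 * m + s - i = (m - i) + (m + s)" by auto
        then show "of_nat (m choose i) * f x ^ i * (- z) ^ (m - i) * z ^ (m + s)
          = of_nat (m choose i) * f x ^ i * (- 1) ^ (m - i) * z ^ (2 * m + s - i)"
          using power_minus[of z "m - i"] by (simp add: power_add)
      qed
      finally show "(f x - z) ^ m * z ^ (m + s)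
        = (\<Sum>i\<le>m. of_nat (m choose i) * f x ^ i * (- 1) ^ (m - i) * z ^ (2 * m + s - i))" .
    qed
    also have "\<dots> = (\<Sum>i\<le>m. of_nat (m choose i) * f x ^ i * (- 1) ^ (m - i) * (\<Sum>z\<in>UNIV. z ^ (2 * m + s - i)))"
      by (subst sum.swap) (simp add: sum_distrib_left)
    also have "\<dots> = (\<Sum>i\<le>m. if i = s then c * f x ^ s else 0)"
    proof (intro sum.cong refl)
      fix i assume i: "i \<in> {..m}"
      have "2 * m + s - i < 2 * (q - 1)" using s m_pos q_eq_m by simp
      moreover have "2 * m + s - i = q - 1 \<longleftrightarrow> i = s" using i q_eq_m by auto
      ultimately show "of_nat (m choose i) * f x ^ i * (- 1) ^ (m - i) * (\<Sum>z\<in>UNIV. z ^ (2 * m + s - i))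
          = (if i = s then c * f x ^ s else 0)"
        using power_sum[of "2 * m + s - i"] by (simp add: c_def)
    qed
    also have "\<dots> = c * f x ^ s" using s by simp
    finally show ?thesis .
  qed
  define A where "A = (\<Sum>y\<in>UNIV. smult (f y ^ (m + s) / c) ([:- y, 1:] ^ m))"
  show thesis
  proof
    show "degree A \<le> m" unfolding A_def
      by (intro degree_sum_le) (auto intro: order_trans[OF degree_smult_le] simp: degree_linear_power)
    fix x
    have "c * poly A x = (\<Sum>y\<in>UNIV. (f x - f y) ^ m * f y ^ (m + s))"
      using c f by (simp add: A_def poly_sum sum_distrib_left mult.commute)
    then show "poly A x = f x ^ s" using extraction c by simp
  qed
qed

lemma degree_le_if_represents_power:
  fixes f :: "'a \<Rightarrow> 'a"
  assumes "\<And>x y. (f x - f y) ^ m = (x - y) ^ m"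
    and "s \<le> m" "of_nat (m choose s) \<noteq> (0 :: 'a)"
    and "degree B < q" "\<And>x. poly B x = f x ^ s"
  shows "degree B \<le> m"
proof -
  obtain A where "degree A \<le> m" "\<And>x. poly A x = f x ^ s"
    using power_represented_degree_le[OF assms(1-3)] by blast
  moreover from this have "B = A"
    using assms(4,5) q_eq_m by (intro poly_eq_if_same_values) auto
  ultimately show ?thesis by simp
qed

lemma preserves_power_m_frobenius:
  fixes f :: "'a \<Rightarrow> 'a"
  assumes "\<And>x y. (f x - f y) ^ m = (x - y) ^ m"
  shows "(f x ^ p ^ r - f y ^ p ^ r) ^ m = (x - y) ^ m"
proof -
  have "(z ^ m) ^ p ^ r = z ^ m" for z :: 'a
    unfolding power_m using odd_p p_ge_3 by (auto simp: power_0_left)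
  then show ?thesis
    by (metis assms frobenius_diff power_mult mult.commute)
qed

lemma h_pos: "h > 0" using p_eq_h p_ge_3 by simp

text \<open>
  Modulo \<open>p\<close>, \<open>2 * (n - i)\<close> is \<open>- (2 * i + 1)\<close>, which is not zero for \<open>i < h\<close>.
\<close>
lemma not_dvd_choose_le_h:
  assumes "2 * n + 1 = p ^ r" "r > 0" "s \<le> h"
  shows "\<not> p dvd (n choose s)"
proof (rule prime_not_dvd_binomial[OF prime_p])
  fix i assume i: "i < s"
  have dvd: "p dvd 2 * n + 1" using assms by simp
  then have "p \<le> 2 * n + 1" by (rule dvd_imp_le) simp
  then have "2 * n + 1 = 2 * (n - i) + (2 * i + 1)" using i assms(3) p_eq_h by simp
  moreover have "\<not> p dvd 2 * i + 1" using i assms(3) p_eq_h by (auto dest!: dvd_imp_le)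
  ultimately show "\<not> p dvd n - i" using dvd by (metis dvd_add_right_iff dvd_mult)
qed

lemma choose_le_h_neq_0: "s \<le> h \<Longrightarrow> of_nat (m choose s) \<noteq> (0 :: 'a)"
  using not_dvd_choose_le_h[of m k s] k_pos q_eq q_eq_m
    of_nat_eq_0_iff_char_dvd[where 'a='a] char_p by simp

lemma h_le_m: "h \<le> m"
proof -
  have "p ^ 1 \<le> p ^ k" using k_pos p_ge_3 by (intro power_increasing) auto
  then show ?thesis using q_eq q_eq_m p_eq_h by simp
qed

text \<open>
  All base-\<open>p\<close> digits of \<open>m\<close> equal \<open>h\<close>, while the digits of \<open>h + p ^ r\<close> are \<open>h\<close>, \<open>1\<close> and zeros, so
  Lucas' theorem leaves no factor divisible by \<open>p\<close>. The split is made at place \<open>r\<close>: \<open>n1\<close> consists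
  of the lower \<open>r\<close> digits of \<open>m\<close> and \<open>n2\<close> of the upper ones.
\<close>
lemma choose_h_plus_power:
  assumes "0 < r" "r < k"
  shows "h + p ^ r \<le> m" "of_nat (m choose (h + p ^ r)) \<noteq> (0 :: 'a)"
proof -
  define n1 n2 where "n1 = (p ^ r - 1) div 2" and "n2 = (p ^ (k - r) - 1) div 2"
  have n1: "2 * n1 + 1 = p ^ r" and n2: "2 * n2 + 1 = p ^ (k - r)"
    using odd_p odd_pos by (auto simp: n1_def n2_def)
  have "p ^ r * p ^ (k - r) = p ^ k" using assms by (simp flip: power_add)
  then have "2 * (n1 + p ^ r * n2) + 1 = p ^ k"
    using n1 by (simp flip: n2 add: algebra_simps)
  then have m: "m = n1 + p ^ r * n2" using q_eq q_eq_m by simp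
  have "p ^ 1 \<le> p ^ r" "p ^ 1 \<le> p ^ (k - r)" using assms p_ge_3 by (intro power_increasing; simp)+
  then have hr: "h < p ^ r" "h \<le> n1" "1 \<le> n2" using p_eq_h n1 n2 h_pos by simp_all
  then have "p ^ r * 1 \<le> p ^ r * n2" by (intro mult_le_mono2)
  then show "h + p ^ r \<le> m" using m hr by linarith
  have "of_nat (m choose (h + p ^ r)) = (of_nat (n1 choose h) * of_nat (n2 choose 1) :: 'a)"
    using binomial_split_prime_power[where 'a='a, of n1 r h n2 1] char_p prime_p n1 hr m by simp
  moreover have "\<not> p dvd (n1 choose h)" "\<not> p dvd (n2 choose 1)"
    using not_dvd_choose_le_h[OF n1, of h] not_dvd_choose_le_h[OF n2, of 1] assms h_pos by auto
  ultimately show "of_nat (m choose (h + p ^ r)) \<noteq> (0 :: 'a)"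
    using of_nat_eq_0_iff_char_dvd[where 'a='a] char_p by simp
qed

lemma q_eq_mult: "q = p * p ^ (k - 1)"
  using q_eq k_pos power_minus_mult[of k p] by (simp add: mult.commute)

text \<open>
  For \<open>s \<le> h\<close>, the degree of \<open>f ^ s\<close> cannot lie between \<open>m + 1\<close> and \<open>q - 1 = 2 * m\<close>. Multiplying by one
  more factor \<open>f\<close> of degree at most \<open>m\<close> cannot jump over this gap, so \<open>h * degree G \<le> m\<close>. In the same
  way the product of \<open>h\<close> copies of \<open>f\<close> and one twist \<open>f ^ p ^ r\<close> has degree at most \<open>m\<close>, and since
  \<open>(h + 1) * p ^ (k - 1) > m\<close> the twist has degree less than \<open>p ^ (k - 1)\<close>. A monomial
  of \<open>f\<close> whose exponent is not a multiple of \<open>p ^ (k - 1)\<close> would contradict this for a suitable \<open>r\<close>,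
  because a coefficient of the twist is the \<open>p ^ r\<close>-th power of a coefficient of \<open>f\<close>.
\<close>
lemma monomial_if_degree_ge:
  fixes f :: "'a \<Rightarrow> 'a"
  assumes f: "\<And>x y. (f x - f y) ^ m = (x - y) ^ m" and f0: "f 0 = 0"
    and G: "\<And>x. poly G x = f x" and deg: "p ^ (k - 1) \<le> degree G" "degree G < q"
  shows "f x = f 1 * x ^ p ^ (k - 1)"
proof -
  define Q where "Q = p ^ (k - 1)"
  have q_Q: "q = p * Q" unfolding Q_def by (rule q_eq_mult)
  have Q_pos: "Q > 0" using p_ge_3 by (simp add: Q_def)
  have two_m: "2 * m + 1 = 2 * (h * Q) + Q"
  proof -
    have "q = (2 * h + 1) * Q" using q_Q unfolding p_eq_h .
    then show ?thesis using q_eq_m by (simp add: add_mult_distrib)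
  qed
  have G_nz: "G \<noteq> 0" using deg p_ge_3 by auto
  have hD: "s * degree G \<le> m" if "s \<le> h" for s
    using that
  proof (induction s)
    case (Suc s)
    have "degree G \<le> m"
      using degree_le_if_represents_power[OF f _ _ deg(2), of 1] choose_le_h_neq_0[of 1] h_pos h_le_m G
      by simp
    then have "degree (G ^ Suc s) < q"
      using Suc q_eq_m by (simp add: degree_power_eq G_nz del: power_Suc)
    then have "degree (G ^ Suc s) \<le> m"
      using Suc.prems h_le_m G
      by (intro degree_le_if_represents_power[OF f _ choose_le_h_neq_0[OF Suc.prems]]) auto
    then show ?case by (simp add: degree_power_eq G_nz del: power_Suc)
  qed simp
  have twist: "\<exists>A. degree A \<le> m \<and> degree A < Q \<and> (\<forall>x. poly A x = f x ^ p ^ r)" if r: "0 < r" "r < k" for r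
  proof -
    obtain A where A: "degree A \<le> m" "\<And>x. poly A x = (f x ^ p ^ r) ^ 1"
      using power_represented_degree_le[OF preserves_power_m_frobenius[OF f], of 1]
        choose_le_h_neq_0[of 1] h_pos h_le_m by auto
    have "f 1 \<noteq> 0" using f[of 1 0] f0 m_pos by (auto simp: power_0_left)
    then have "A \<noteq> 0" using A(2)[of 1] by auto
    then have d: "degree (G ^ h * A) = h * degree G + degree A"
      using G_nz by (simp add: degree_mult_eq degree_power_eq)
    then have "degree (G ^ h * A) < q" using hD[of h] A(1) q_eq_m by simp
    then have "degree (G ^ h * A) \<le> m"
      by (rule degree_le_if_represents_power[OF f choose_h_plus_power[OF r]])
         (simp add: G A(2) power_add)
    then have "h * degree G + degree A \<le> m" using d by simp
    moreover have "h * Q \<le> h * degree G" using deg by (simp add: Q_def)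
    ultimately have "degree A < Q" using two_m Q_pos by linarith
    then show ?thesis using A by auto
  qed
  have D_le: "degree G \<le> m" using hD[of 1] h_pos by simp
  have coeff_0: "coeff G j = 0" if j: "\<not> Q dvd j" "j \<le> m" for j
  proof -
    define A' B where "A' = j div Q" and "B = j mod Q"
    have jAB: "j = A' * Q + B" by (simp add: A'_def B_def)
    have B: "0 < B" "B < Q" using j Q_pos by (auto simp: B_def dvd_eq_mod_eq_0)
    have "A' * Q < p * Q" using jAB j(2) q_Q q_eq_m by linarith
    then have A'_less: "A' < p" by simp
    have "1 * Q \<le> p * Q" using p_ge_3 by (intro mult_le_mono1) simp
    then have "B < q" "2 \<le> p" using B q_Q p_ge_3 by linarith+
    with B(1) obtain r where r: "B * p ^ r < q" "q \<le> B * p ^ Suc r"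
      by (rule ex_max_shift)
    have "r \<noteq> 0"
    proof
      assume "r = 0"
      then have "p * Q \<le> p * B" using r q_Q by (simp add: mult.commute)
      then show False using B p_ge_3 by simp
    qed
    moreover have "r < k"
    proof -
      have "1 * p ^ r \<le> B * p ^ r" using B by (intro mult_le_mono1) simp
      then have "p ^ r < p ^ k" using r q_eq by linarith
      then show ?thesis using p_ge_3 by (simp add: power_less_imp_less_exp)
    qed
    ultimately have r_range: "0 < r" "r < k" by auto
    then obtain A where A: "degree A \<le> m" "degree A < Q" "\<And>x. poly A x = f x ^ p ^ r"
      using twist by blast
    (* the exponent j * p^r reduced by x^q = x, that is, with its base-p digits rotated by r;
       r is chosen such that a non-zero digit of B arrives at the top place *)
    define i where "i = A' * p ^ (r - 1) + B * p ^ r"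
    have pr: "p ^ r = p * p ^ (r - 1)" using r_range power_minus_mult[of r p] by (simp add: mult.commute)
    have i_less: "i < q"
    proof -
      have qr: "q = p ^ (k - r) * p ^ r" using r_range q_eq by (simp flip: power_add)
      then have "B < p ^ (k - r)" using r by simp
      then have "Suc B * p ^ r \<le> q" unfolding qr by (intro mult_le_mono1) simp
      moreover have "A' * p ^ (r - 1) < p ^ r" unfolding pr using A'_less p_ge_3 by simp
      ultimately show ?thesis by (simp add: i_def)
    qed
    have "p * Q \<le> p * (B * p ^ r)" using r q_Q by (simp add: algebra_simps)
    then have "Q \<le> B * p ^ r" using p_ge_3 by simp
    then have i_ge: "Q \<le> i" by (simp add: i_def)
    have pow: "x ^ ((q - 1 - j) * p ^ r) = x ^ (q - 1 - i)" if "x \<noteq> 0" for x :: 'a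
    proof -
      have "Q * p ^ r = q * p ^ (r - 1)" using q_Q pr by simp
      then have "x ^ (j * p ^ r) = (x ^ q) ^ (A' * p ^ (r - 1)) * x ^ (B * p ^ r)"
        unfolding jAB by (simp add: algebra_simps flip: power_add power_mult)
      then have ji: "x ^ (j * p ^ r) = x ^ i" by (simp add: power_card i_def power_add)
      have "(q - 1 - j) * p ^ r + j * p ^ r = (q - 1) * p ^ r"
        using j q_eq_m by (simp flip: add_mult_distrib)
      then have "x ^ ((q - 1 - j) * p ^ r) * x ^ (j * p ^ r) = 1"
        unfolding power_add[symmetric] by (simp only: power_mult power_card_minus_1[OF that] power_one)
      moreover have "x ^ (q - 1 - i) * x ^ i = 1"
        using power_card_minus_1[OF that] i_less by (simp flip: power_add)
      moreover have "x ^ i \<noteq> 0" using that by simp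
      ultimately show ?thesis unfolding ji by (metis mult_right_cancel)
    qed
    have j_range: "0 < j" "j \<le> q - 1" using j q_eq_m by (auto intro: gr0I)
    have "(- coeff G j) ^ p ^ r = (\<Sum>x\<in>UNIV. poly G x * x ^ (q - 1 - j)) ^ p ^ r"
      using coeff_eq_power_sum[OF D_le j_range] by simp
    also have "\<dots> = (\<Sum>x\<in>UNIV. poly A x * x ^ (q - 1 - i))"
      unfolding frobenius_sum
    proof (intro sum.cong refl)
      fix x
      show "(poly G x * x ^ (q - 1 - j)) ^ p ^ r = poly A x * x ^ (q - 1 - i)"
        using pow[of x] f0 p_ge_3
        by (cases "x = 0") (simp_all add: G A(3) power_mult_distrib power_0_left flip: power_mult)
    qed
    also have "\<dots> = - coeff A i"
      using coeff_eq_power_sum[OF A(1)] i_less i_ge Q_pos by simp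
    also have "\<dots> = 0" using A(2) i_ge by (simp add: coeff_eq_0)
    finally show ?thesis by simp
  qed
  have "coeff G (degree G) \<noteq> 0" using G_nz by simp
  then have "Q dvd degree G" using coeff_0 D_le by blast
  then obtain a where a: "degree G = Q * a" by (rule dvdE)
  (* 2 * h * Q exceeds m, so the degree bound leaves only the exponent Q itself *)
  have "a < 2"
  proof (rule ccontr)
    assume "\<not> a < 2"
    then have "h * (Q * 2) \<le> h * degree G" unfolding a by (intro mult_le_mono2) simp
    then have "4 * (h * Q) \<le> 2 * m" using hD[of h] by linarith
    moreover note two_m
    moreover have "1 * Q \<le> h * Q" using h_pos by (intro mult_le_mono1) simp
    ultimately show False using Q_pos by linarith
  qed
  moreover have "a \<noteq> 0" using a deg Q_pos by (auto simp: Q_def)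
  ultimately have DQ: "degree G = Q" using a by (cases a) auto
  have "coeff G j = 0" if "j \<noteq> Q" for j
  proof (cases "j = 0 \<or> j > Q")
    case True
    then show ?thesis using G[of 0] f0 DQ by (auto simp: poly_0_coeff_0 coeff_eq_0)
  next
    case False
    then have "0 < j" "j < Q" using that by auto
    then have "\<not> Q dvd j" by (rule nat_dvd_not_less)
    then show ?thesis using coeff_0 \<open>j < Q\<close> D_le DQ by simp
  qed
  then have "G = monom (coeff G Q) Q" by (intro poly_eqI) simp
  then obtain c where c: "G = monom c Q" by blast
  have val: "f x = c * x ^ Q" for x using G[of x] by (simp add: c poly_monom)
  show ?thesis using val[of x] val[of 1] by (simp add: Q_def)
qed

text \<open>
  With \<open>u\<close> maximal such that \<open>d * p ^ u < q\<close>, where \<open>d\<close> is the degree of \<open>f\<close>, the polynomial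
  of the twist \<open>f ^ p ^ u\<close> is simply a power of that of \<open>f\<close>, and its degree is at least
  \<open>p ^ (k - 1)\<close>. The twist is undone by raising to the power \<open>p ^ (k - u)\<close>, as \<open>x ^ q = x\<close>.
\<close>
lemma preserves_power_m_imp_frobenius:
  fixes f :: "'a \<Rightarrow> 'a"
  assumes f: "\<And>x y. (f x - f y) ^ m = (x - y) ^ m" and f0: "f 0 = 0"
  obtains l where "l < k" "\<And>x. f x = f 1 * x ^ p ^ l"
proof -
  obtain F where F: "degree F \<le> m" "\<And>x. poly F x = f x"
    using power_represented_degree_le[OF f, of 1] choose_le_h_neq_0[of 1] h_pos h_le_m by auto
  have "f 1 \<noteq> f 0" using f[of 1 0] m_pos by (auto simp: power_0_left)
  have "degree F > 0"
  proof (rule ccontr)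
    assume "\<not> ?thesis"
    then obtain c where "F = [:c:]" by (auto elim: degree_eq_zeroE)
    then show False using F(2)[of 0] F(2)[of 1] \<open>f 1 \<noteq> f 0\<close> by simp
  qed
  then obtain u where u: "degree F * p ^ u < q" "q \<le> degree F * p ^ Suc u"
    using ex_max_shift[of "degree F" q p] F q_eq_m p_ge_3 by auto
  have "1 * p ^ u \<le> degree F * p ^ u" using \<open>degree F > 0\<close> by (intro mult_le_mono1) simp
  then have "p ^ u < p ^ k" using u q_eq by linarith
  then have uk: "u < k" using p_ge_3 by (simp add: power_less_imp_less_exp)
  have degG: "degree (F ^ p ^ u) = degree F * p ^ u"
    using \<open>degree F > 0\<close> by (subst degree_power_eq) auto
  have "p * p ^ (k - 1) \<le> p * (degree F * p ^ u)"
    using u unfolding q_eq_mult by (simp add: mult_ac)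
  then have "p ^ (k - 1) \<le> degree (F ^ p ^ u)" using degG p_ge_3 by simp
  then have g: "f x ^ p ^ u = f 1 ^ p ^ u * x ^ p ^ (k - 1)" for x
    using u f0 p_ge_3 F(2) degG
    by (intro monomial_if_degree_ge[OF preserves_power_m_frobenius[OF f], where G="F ^ p ^ u"])
       (auto simp: power_0_left)
  have pu: "(y ^ p ^ u) ^ p ^ (k - u) = y" for y :: 'a
    using uk power_card[of y] q_eq by (simp flip: power_mult power_add)
  have exps: "p ^ (k - 1) * p ^ (k - u) = q * p ^ (k - 1 - u)"
    using uk q_eq by (simp flip: power_add)
  have "f x = f 1 * x ^ p ^ (k - 1 - u)" for x
  proof -
    have "f x = (f 1 ^ p ^ u * x ^ p ^ (k - 1)) ^ p ^ (k - u)" using g[of x] pu[of "f x"] by simp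
    also have "\<dots> = f 1 * x ^ (p ^ (k - 1) * p ^ (k - u))"
      by (simp only: power_mult_distrib pu flip: power_mult[of x])
    also have "x ^ (p ^ (k - 1) * p ^ (k - u)) = x ^ p ^ (k - 1 - u)"
      unfolding exps power_mult power_card ..
    finally show ?thesis .
  qed
  moreover have "k - 1 - u < k" using k_pos by simp
  ultimately show thesis by (rule that[rotated])
qed

lemma field_isom_frobenius: "field_isom (\<lambda>x :: 'a. x ^ p ^ l)"
proof -
  have "inj (\<lambda>x :: 'a. x ^ p ^ l)"
  proof (rule injI)
    fix x y :: 'a assume "x ^ p ^ l = y ^ p ^ l"
    then have "(x - y) ^ p ^ l = 0" by (simp add: frobenius_diff)
    then show "x = y" by simp
  qed
  then have "surj (\<lambda>x :: 'a. x ^ p ^ l)" by (simp add: finite_UNIV_inj_surj)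
  then show ?thesis
    using p_ge_3 by unfold_locales (auto simp: frobenius_add power_mult_distrib power_0_left)
qed

lemma quadratic_char_preserved_imp_frobenius:
  fixes f :: "'a \<Rightarrow> 'a"
  assumes "f 0 = 0" "\<forall>a b. quadratic_char (f a - f b) = quadratic_char (a - b)"
  shows "\<exists>c\<in>pos. \<exists>l\<in>{0..k - 1}. \<forall>x. f x = c * x ^ (p ^ l)"
proof -
  have "(f x - f y) ^ m = (x - y) ^ m" for x y
    using assms(2) quadratic_char_preserved_iff[of f] by blast
  then obtain l where l: "l < k" "\<And>x. f x = f 1 * x ^ p ^ l"
    using preserves_power_m_imp_frobenius[of f] assms(1) by blast
  have "quadratic_char (f 1) = quadratic_char (1 :: 'a)"
    using spec[OF spec[OF assms(2), of 1], of 0] assms(1) by simp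
  then have "f 1 \<in> pos" by (simp add: quadratic_char_eq_iff)
  moreover have "l \<in> {0..k - 1}" using l(1) by auto
  ultimately show ?thesis using l(2) by blast
qed

end

section \<open>The equivalence\<close>

theorem theorem2:
  fixes f :: "'a::{field,finite} \<Rightarrow> 'a" and p k q :: nat
  assumes "prime p" and "q = p ^ k" and "[q = 3] (mod 4)" and "card (UNIV :: 'a set) = q"
  shows
    "((\<exists>n\<ge>2. preserves_positivity n f) \<longleftrightarrow> (\<forall>n\<ge>2. preserves_positivity n f)) \<and>
     ((\<forall>n\<ge>2. preserves_positivity n f) \<longleftrightarrow>
        f 0 = 0 \<and> (\<forall>a b. quadratic_char (f a - f b) = quadratic_char (a - b))) \<and>
     (f 0 = 0 \<and> (\<forall>a b. quadratic_char (f a - f b) = quadratic_char (a - b)) \<longleftrightarrow>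
        (\<exists>c\<in>positive_elems. \<exists>\<sigma>. field_isom \<sigma> \<and> (\<forall>x. f x = c * \<sigma> x))) \<and>
     ((\<exists>c\<in>positive_elems. \<exists>\<sigma>. field_isom \<sigma> \<and> (\<forall>x. f x = c * \<sigma> x)) \<longleftrightarrow>
        (\<exists>c\<in>positive_elems. \<exists>l\<in>{0..k - 1}. \<forall>x. f x = c * x ^ (p ^ l)))"
proof -
  define m h where "m = (q - 1) div 2" and "h = (p - 1) div 2"
  have q4: "q mod 4 = 3" using assms(3) by (simp add: cong_def)
  then have m: "q = 2 * m + 1" "odd m" unfolding m_def by presburger+
  have "odd (p ^ k)" using m(1) assms(2) by (metis even_plus_one_iff dvd_triv_left)
  moreover have "k \<noteq> 0" using q4 assms(2) by (intro notI) simp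
  ultimately have "odd p" by simp
  then have "p = 2 * h + 1" using odd_two_times_div_two_succ[of p] by (simp add: h_def)
  then interpret field_card_3_mod_4 p k q m h "TYPE('a)"
    using assms m by unfold_locales auto
  let ?some = "\<exists>n\<ge>2. preserves_positivity n f"
  let ?all = "\<forall>n\<ge>2. preserves_positivity n f"
  let ?char = "f 0 = 0 \<and> (\<forall>a b. quadratic_char (f a - f b) = quadratic_char (a - b))"
  let ?isom = "\<exists>c\<in>positive_elems. \<exists>\<sigma>. field_isom \<sigma> \<and> (\<forall>x. f x = c * \<sigma> x)"
  let ?frob = "\<exists>c\<in>positive_elems. \<exists>l\<in>{0..k - 1}. \<forall>x. f x = c * x ^ (p ^ l)"
  have "?all \<Longrightarrow> ?some" by blast
  moreover have "?some \<Longrightarrow> ?char" using preserves_quadratic_char by blast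
  moreover have "?char \<Longrightarrow> ?frob" using quadratic_char_preserved_imp_frobenius by blast
  moreover have "?frob \<Longrightarrow> ?isom" using field_isom_frobenius by blast
  moreover have "?isom \<Longrightarrow> ?all" using multiple_of_field_isom_preserves_positivity by blast
  ultimately show ?thesis by argo
qed

end
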